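(* Let $n\ge 1$ be a natural number, let $k$ be an integer with $0\le k\le \lfloor n/2\rfloor$, and let $a,b,\alpha,\beta$ be any real numbers with $\beta a-\alpha b\neq 0$. Then $$\Psi\left(\begin{array}{cc|c} a & b & n\\ \alpha & \beta & k\end{array}\right)=\sum_{r=0}^{\lfloor n/2\rfloor-k}(-1)^{r+k}\,\frac{(n-r-k-1)!\;n}{(n-2r)!\;r!}\binom{\lfloor n/2\rfloor-r}{k}\,\Omega_r(k|\alpha,\beta|n)\;a^{r}\,(2a-b)^{\lfloor n/2\rfloor-k-r},$$ where the coefficients $$(-1)^{r+k}\,\frac{(n-r-k-1)!\;n}{(n-2r)!\;r!}\binom{\lfloor n/2\rfloor-r}{k}\,\Omega_r(k|\alpha,\beta|n)$$ are integers.
   Context: For a natural number $m$, $\delta(m)\in\{0,1\}$ denotes $m \bmod 2$. The convention $0^0=1$ is used. The polynomials $\Psi\left(\begin{array}{cc|c} a & b & n\\ \alpha & \beta & r\end{array}\right)$, $0\le r\le\lfloor n/2\rfloor$, are the unique polynomials in $a,b,\alpha,\beta$ with integer coefficients (depending only on $a,b,\alpha,\beta,n,r$) satisfying the polynomial identity in $x,y$ $$(\beta a-\alpha b)^{\lfloor n/2\rfloor}\,\frac{x^n+y^n}{(x+y)^{\delta(n)}}=\sum_{r=0}^{\lfloor n/2\rfloor}\Psi\left(\begin{array}{cc|c} a & b & n\\ \alpha & \beta & r\end{array}\right)(\alpha x^2+\beta xy+\alpha y^2)^{\lfloor n/2\rfloor-r}(ax^2+bxy+ay^2)^r .$$ The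 Quanta Prime Sequence $\Omega_r(k|\zeta,\xi|n)$ associated with $n$ and a point $(\zeta,\xi)\ne(0,0)$ is defined for integers $r,k\ge 0$ with $r+k\le\lfloor n/2\rfloor$ by $\Omega_r(0|\zeta,\xi|n)=1$ for all $r$, and for $k\ge1$ $$\Omega_r(k|\zeta,\xi|n)=(2\zeta-\xi)(n-r-k)\,\Omega_r(k-1|\zeta,\xi|n)-2\zeta\,(n-2r-\delta(n-1))\,\Omega_{r+1}(k-1|\zeta,\xi|n).$$
   Formalization: For arbitrary real α, β the coefficients need not be integers (n=2, k=1, r=0 gives β); the formal claim is that each coefficient is a polynomial in α, β with integer coefficients, and is an integer whenever α and β are integers. *)

theory Defs
  imports Complex_Main "HOL-Computational_Algebra.Polynomial"
begin

definition delta :: "nat \<Rightarrow> nat" where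
  "delta m = m mod 2"

text \<open>
  The ring \<open>\<int>[a, b, \<alpha>, \<beta>]\<close> is represented as \<open>\<int>[a][b][\<alpha>][\<beta>]\<close>, with \<open>a\<close> the innermost and \<open>\<beta>\<close>
  the outermost variable.
\<close>

type_synonym zpoly4 = "int poly poly poly poly"

definition Var_a :: zpoly4 where "Var_a = [:[:[:[:0, 1:]:]:]:]"
definition Var_b :: zpoly4 where "Var_b = [:[:[:0, 1:]:]:]"
definition Var_alpha :: zpoly4 where "Var_alpha = [:[:0, 1:]:]"
definition Var_beta :: zpoly4 where "Var_beta = [:0, 1:]"

text \<open>
  Evaluation at real points; the arguments are listed from the innermost variable to the
  outermost one.
\<close>

definition eval2 :: "int poly poly \<Rightarrow> real \<Rightarrow> real \<Rightarrow> real" where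
  "eval2 p s t = poly (map_poly (\<lambda>q. poly (map_poly of_int q) s) p) t"

definition eval4 :: "zpoly4 \<Rightarrow> real \<Rightarrow> real \<Rightarrow> real \<Rightarrow> real \<Rightarrow> real" where
  "eval4 P a b \<alpha> \<beta> =
     poly (map_poly (\<lambda>Q. poly (map_poly (\<lambda>q. eval2 q a b) Q) \<alpha>) P) \<beta>"

text \<open>
  Polynomials in \<open>x\<close> (inner variable) and \<open>y\<close> (outer variable) over \<open>\<int>[a, b, \<alpha>, \<beta>]\<close>.
\<close>

definition Const_xy :: "zpoly4 \<Rightarrow> zpoly4 poly poly" where "Const_xy c = [:[:c:]:]"
definition Var_x :: "zpoly4 poly poly" where "Var_x = [:[:0, 1:]:]"
definition Var_y :: "zpoly4 poly poly" where "Var_y = [:0, 1:]"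

definition quad_form :: "zpoly4 \<Rightarrow> zpoly4 \<Rightarrow> zpoly4 poly poly" where
  "quad_form c d = Const_xy c * Var_x ^ 2 + Const_xy d * Var_x * Var_y + Const_xy c * Var_y ^ 2"

text \<open>
  The division below is exact: \<open>x + y\<close> divides \<open>x ^ n + y ^ n\<close> for odd \<open>n\<close>, and
  \<open>delta n = 0\<close> for even \<open>n\<close>.
\<close>

definition Psi_identity :: "nat \<Rightarrow> (nat \<Rightarrow> zpoly4) \<Rightarrow> bool" where
  "Psi_identity n P \<longleftrightarrow>
     Const_xy (Var_beta * Var_a - Var_alpha * Var_b) ^ (n div 2) *
       ((Var_x ^ n + Var_y ^ n) div (Var_x + Var_y) ^ delta n) =
     (\<Sum>r = 0..n div 2. Const_xy (P r) *
        quad_form Var_alpha Var_beta ^ (n div 2 - r) * quad_form Var_a Var_b ^ r)"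

text \<open>
  Only the indices \<open>r \<le> n div 2\<close> are constrained by the identity; the others are set to \<open>0\<close>
  so that the family is unique as a function on \<^typ>\<open>nat\<close>.
\<close>

definition Psi_poly :: "nat \<Rightarrow> nat \<Rightarrow> zpoly4" where
  "Psi_poly n = (THE P. Psi_identity n P \<and> (\<forall>r. r > n div 2 \<longrightarrow> P r = 0))"

definition Psi :: "real \<Rightarrow> real \<Rightarrow> real \<Rightarrow> real \<Rightarrow> nat \<Rightarrow> nat \<Rightarrow> real" where
  "Psi a b \<alpha> \<beta> n r = eval4 (Psi_poly n r) a b \<alpha> \<beta>"

text \<open>
  The quanta prime sequence; \<open>Omega r k \<zeta> \<xi> n\<close> is meaningful for \<open>n \<ge> 1\<close>, \<open>r + k \<le> n div 2\<close> and
  \<open>(\<zeta>, \<xi>) \<noteq> (0, 0)\<close>.  On this domain the recursion only refers to values in the domain.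
\<close>

primrec Omega :: "nat \<Rightarrow> nat \<Rightarrow> real \<Rightarrow> real \<Rightarrow> nat \<Rightarrow> real" where
  "Omega r 0 \<zeta> \<xi> n = 1"
| "Omega r (Suc k) \<zeta> \<xi> n =
     (2 * \<zeta> - \<xi>) * (real n - real r - real (Suc k)) * Omega r k \<zeta> \<xi> n
     - 2 * \<zeta> * (real n - 2 * real r - real (delta (n - 1))) * Omega (Suc r) k \<zeta> \<xi> n"

text \<open>
  The natural-number subtractions do not truncate when \<open>n \<ge> 1\<close> and \<open>r + k \<le> n div 2\<close>.
\<close>

definition Psi_coeff :: "nat \<Rightarrow> nat \<Rightarrow> nat \<Rightarrow> real \<Rightarrow> real \<Rightarrow> real" where
  "Psi_coeff n k r \<alpha> \<beta> =
     (-1) ^ (r + k) * (fact (n - r - k - 1) * real n / (fact (n - 2 * r) * fact r)) *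
     real ((n div 2 - r) choose k) * Omega r k \<alpha> \<beta> n"

end

theory Submission
  imports Defs "HOL-Computational_Algebra.Polynomial_Factorial"
begin

text \<open>
  Write \<open>m = n div 2\<close>, \<open>A\<close> and \<open>B\<close> for the quadratic forms with coefficients \<open>\<alpha>, \<beta>\<close> and \<open>a, b\<close>,
  and \<open>D = \<beta> a - \<alpha> b\<close>. Waring's formula writes \<open>(x ^ n + y ^ n) / (x + y) ^ delta n\<close> as a form of
  degree \<open>m\<close> in \<open>p = x y\<close> and \<open>s = (x + y)\<^sup>2\<close>. Since \<open>D p = a A - \<alpha> B\<close> and
  \<open>D s = (2 a - b) A - (2 \<alpha> - \<beta>) B\<close>, multiplying by \<open>D ^ m\<close> and expanding binomially yields the
  coefficient of \<open>A ^ (m - k) B ^ k\<close> as a polynomial in \<open>a\<close> and \<open>2 a - b\<close>. Its coefficients are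
  visibly integral, and solving the recursion for \<open>\<Omega>\<close> identifies them with the stated ones.
  The expansion is unique because \<open>B / A\<close> takes infinitely many values at \<open>y = 1\<close>, \<open>x = 2, 3, \<dots>\<close>.
\<close>

section \<open>Unital ring homomorphisms\<close>

locale unital_ring_hom =
  fixes h :: "'a :: comm_ring_1 \<Rightarrow> 'b :: comm_ring_1"
  assumes hom_1: "h 1 = 1"
    and hom_add: "h (x + y) = h x + h y"
    and hom_mult: "h (x * y) = h x * h y"
begin

lemma hom_0: "h 0 = 0"
  using hom_add[of 0 0] by simp

lemma hom_minus: "h (- x) = - h x"
  using hom_add[of x "- x"] by (simp add: hom_0 eq_neg_iff_add_eq_0 add.commute)

lemma hom_diff: "h (x - y) = h x - h y"
  using hom_add[of x "- y"] by (simp add: hom_minus)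

lemma hom_power: "h (x ^ n) = h x ^ n"
  by (induction n) (simp_all add: hom_1 hom_mult)

lemma hom_sum: "h (sum f A) = (\<Sum>i\<in>A. h (f i))"
  by (induction A rule: infinite_finite_induct) (simp_all add: hom_0 hom_add)

lemma hom_of_nat: "h (of_nat n) = of_nat n"
  by (induction n) (simp_all add: hom_0 hom_1 hom_add)

lemma hom_numeral: "h (numeral k) = numeral k"
  using hom_of_nat[of "numeral k"] by simp

lemmas homs = hom_0 hom_1 hom_add hom_mult hom_minus hom_diff hom_power hom_sum hom_of_nat
  hom_numeral

text \<open>Starting from \<open>of_int\<close>, repeated use makes \<open>eval2\<close> and
  \<open>eval4\<close> homomorphisms, one polynomial layer at a time.\<close>

lemma unital_ring_hom_poly_map_poly: "unital_ring_hom (\<lambda>p. poly (map_poly h p) t)"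
proof
  show "poly (map_poly h 1) t = 1"
    by (simp add: hom_1)
  have "map_poly h (p + q) = map_poly h p + map_poly h q" for p q
    by (simp add: poly_eq_iff coeff_map_poly homs)
  then show "poly (map_poly h (p + q)) t = poly (map_poly h p) t + poly (map_poly h q) t" for p q
    by simp
  have "map_poly h (p * q) = map_poly h p * map_poly h q" for p q
    by (simp add: poly_eq_iff coeff_map_poly coeff_mult homs)
  then show "poly (map_poly h (p * q)) t = poly (map_poly h p) t * poly (map_poly h q) t" for p q
    by simp
qed

end

lemma unital_ring_hom_of_int: "unital_ring_hom (of_int :: int \<Rightarrow> real)"
  by unfold_locales simp_all

lemma unital_ring_hom_eval2: "unital_ring_hom (\<lambda>p. eval2 p s t)"
  unfolding eval2_def
  by (intro unital_ring_hom.unital_ring_hom_poly_map_poly unital_ring_hom_of_int)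

lemma unital_ring_hom_eval4: "unital_ring_hom (\<lambda>p. eval4 p a b \<alpha> \<beta>)"
  unfolding eval4_def
  by (intro unital_ring_hom.unital_ring_hom_poly_map_poly unital_ring_hom_eval2)

lemma unital_ring_hom_Const_xy: "unital_ring_hom Const_xy"
  by unfold_locales (simp_all add: Const_xy_def one_pCons)

lemma unital_ring_hom_to_fract: "unital_ring_hom (to_fract :: 'a :: idom \<Rightarrow> 'a fract)"
  by unfold_locales simp_all

lemma eval2_vars: "eval2 [:[:0, 1:]:] s t = s" "eval2 [:0, 1:] s t = t"
  by (simp_all add: eval2_def map_poly_pCons)

lemma eval4_vars:
  "eval4 Var_a a b \<alpha> \<beta> = a" "eval4 Var_b a b \<alpha> \<beta> = b"
  "eval4 Var_alpha a b \<alpha> \<beta> = \<alpha>" "eval4 Var_beta a b \<alpha> \<beta> = \<beta>"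
  by (simp_all add: eval4_def eval2_def map_poly_pCons Var_a_def Var_b_def Var_alpha_def Var_beta_def)


section \<open>Power sums in terms of elementary symmetric polynomials\<close>

text \<open>For \<open>n \<ge> 1\<close> and \<open>2 * i \<le> n\<close> this is the unsigned
  Waring coefficient n/(n-i) * (n-i choose i). The recursion keeps it a natural number; the value 2
  at \<open>0 0\<close> is x^0 + y^0.\<close>

fun lucas_coeff :: "nat \<Rightarrow> nat \<Rightarrow> nat" where
  "lucas_coeff 0 0 = 2"
| "lucas_coeff (Suc n) 0 = 1"
| "lucas_coeff 0 (Suc i) = 0"
| "lucas_coeff (Suc 0) (Suc i) = 0"
| "lucas_coeff (Suc (Suc n)) (Suc i) = lucas_coeff (Suc n) (Suc i) + lucas_coeff n i"

lemma lucas_coeff_eq_0: "n < 2 * i \<Longrightarrow> lucas_coeff n i = 0"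
  by (induction n i rule: lucas_coeff.induct) auto

lemma lucas_coeff_fact:
  assumes "n \<ge> 1" "2 * i \<le> n"
  shows "lucas_coeff n i * fact (n - 2 * i) * fact i = n * fact (n - i - 1)"
  using assms
proof (induction n i rule: lucas_coeff.induct)
  case (2 n)
  then show ?case by simp
next
  case (5 n i)
  \<comment> \<open>The factorial formula fails at index 0, where the coefficient is 2, so
    \<open>n = 0\<close> has no induction hypothesis for \<open>lucas_coeff n i\<close>.\<close>
  show ?case
  proof (cases "n = 0")
    case True
    with 5 show ?thesis by simp
  next
    case n: False
    have IH2: "lucas_coeff n i * fact (n - 2 * i) * fact i = n * fact (n - i - 1)"
      using 5 n by simp
    show ?thesis
    \<comment> \<open>At \<open>2 * i = n\<close> the index \<open>Suc i\<close> exceeds half of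
      \<open>Suc n\<close>, so only \<open>lucas_coeff n i\<close> survives, and it equals
      2.\<close>
    proof (cases "2 * i = n")
      case True
      then have zero: "lucas_coeff (Suc n) (Suc i) = 0"
        by (intro lucas_coeff_eq_0) simp
      have "lucas_coeff n i * fact i = 2 * (i * fact (i - 1))"
        using IH2 unfolding True[symmetric] by simp
      also have "i * fact (i - 1) = fact i"
        using True n by (cases i) simp_all
      finally have "lucas_coeff n i = 2" by simp
      then show ?thesis using zero unfolding True[symmetric] by simp
    next
      case False
      then have le: "2 * Suc i \<le> Suc n" using 5(4) by simp
      define d where "d = Suc n - 2 * Suc i"
      have nd: "n = 2 * i + d + 1" using le d_def by simp
      have IH1: "lucas_coeff (Suc n) (Suc i) * fact d * fact (Suc i) = Suc n * fact (i + d)"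
        using 5(1) le by (simp add: nd)
      have IH2': "lucas_coeff n i * fact (Suc d) * fact i = n * fact (i + d)"
        using IH2 by (simp add: nd)
      \<comment> \<open>The weights \<open>Suc d\<close> and \<open>Suc i\<close> complete the
        factorials of the two recursive terms.\<close>
      have "lucas_coeff (Suc (Suc n)) (Suc i) * fact (Suc d) * fact (Suc i) =
          Suc d * (lucas_coeff (Suc n) (Suc i) * fact d * fact (Suc i)) +
          Suc i * (lucas_coeff n i * fact (Suc d) * fact i)"
        by (simp add: algebra_simps)
      also have "\<dots> = Suc (Suc n) * fact (Suc (i + d))"
        unfolding IH1 IH2' by (simp add: nd algebra_simps)
      finally show ?thesis by (simp add: nd)
    qed
  qed
qed auto

text \<open>Both sides satisfy f(n+2) = (x+y) f(n+1) - xy f(n) with initial values 2 and x+y; the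
  induction therefore carries two consecutive indices.\<close>

lemma power_sum_lucas:
  fixes x y :: "'a :: comm_ring_1"
  shows "x ^ n + y ^ n =
    (\<Sum>i\<le>n div 2. (-1) ^ i * of_nat (lucas_coeff n i) * (x * y) ^ i * (x + y) ^ (n - 2 * i))"
proof -
  \<comment> \<open>Coefficients vanish beyond \<open>n div 2\<close>, so a larger bound
    \<open>N\<close> changes nothing; bounds without \<open>div\<close> spare a parity split in
    \<open>rec\<close>.\<close>
  define L where "L n N = (\<Sum>i\<le>N. (-1) ^ i * of_nat (lucas_coeff n i) * (x * y) ^ i *
      (x + y) ^ (n - 2 * i))" for n N
  have zero: "lucas_coeff n i = 0" if "\<not> i \<le> n div 2" for n i
    using that by (intro lucas_coeff_eq_0) simp
  have L_eq: "L n N = L n (n div 2)" if "n div 2 \<le> N" for n N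
    unfolding L_def using that
    by (intro sum.mono_neutral_right) (auto simp: zero)
  have rec: "L (Suc (Suc n)) (Suc n) = (x + y) * L (Suc n) (Suc n) - x * y * L n n" for n
  proof -
    \<comment> \<open>The exponent on the right truncates once \<open>2 * Suc i > Suc n\<close>, but
      there the coefficient is 0.\<close>
    have eq: "(x + y) ^ (n - 2 * i) * of_nat (lucas_coeff (Suc n) (Suc i)) =
        (x + y) * ((x + y) ^ (Suc n - 2 * Suc i) * of_nat (lucas_coeff (Suc n) (Suc i)))" for i
    proof (cases "2 * Suc i \<le> Suc n")
      case True
      then have "n - 2 * i = Suc (Suc n - 2 * Suc i)" by simp
      then show ?thesis by (simp add: mult_ac)
    qed (simp add: lucas_coeff_eq_0)
    have "L (Suc (Suc n)) (Suc n) = (x + y) ^ Suc (Suc n) +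
        (\<Sum>i\<le>n. (-1) ^ Suc i * of_nat (lucas_coeff (Suc (Suc n)) (Suc i)) * (x * y) ^ Suc i *
          (x + y) ^ (n - 2 * i))"
      unfolding L_def sum.atMost_Suc_shift by simp
    also have "(\<Sum>i\<le>n. (-1) ^ Suc i * of_nat (lucas_coeff (Suc (Suc n)) (Suc i)) * (x * y) ^ Suc i *
          (x + y) ^ (n - 2 * i)) =
        (\<Sum>i\<le>n. (-1) ^ Suc i * (x * y) ^ Suc i * ((x + y) ^ (n - 2 * i) * of_nat (lucas_coeff (Suc n) (Suc i)))) +
        (\<Sum>i\<le>n. - (x * y) * ((-1) ^ i * of_nat (lucas_coeff n i) * (x * y) ^ i * (x + y) ^ (n - 2 * i)))"
      unfolding sum.distrib[symmetric] by (intro sum.cong) (simp_all add: algebra_simps)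
    also have "(\<Sum>i\<le>n. - (x * y) * ((-1) ^ i * of_nat (lucas_coeff n i) * (x * y) ^ i * (x + y) ^ (n - 2 * i)))
        = - (x * y) * L n n"
      unfolding L_def sum_distrib_left ..
    also have "(\<Sum>i\<le>n. (-1) ^ Suc i * (x * y) ^ Suc i * ((x + y) ^ (n - 2 * i) * of_nat (lucas_coeff (Suc n) (Suc i))))
       = (x + y) * (\<Sum>i\<le>n. (-1) ^ Suc i * of_nat (lucas_coeff (Suc n) (Suc i)) * (x * y) ^ Suc i *
          (x + y) ^ (Suc n - 2 * Suc i))"
      unfolding sum_distrib_left eq by (intro sum.cong refl) (simp only: mult_ac)
    also have "(x + y) ^ Suc (Suc n) + ((x + y) * (\<Sum>i\<le>n. (-1) ^ Suc i *
         of_nat (lucas_coeff (Suc n) (Suc i)) * (x * y) ^ Suc i * (x + y) ^ (Suc n - 2 * Suc i)) +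
        - (x * y) * L n n) = (x + y) * L (Suc n) (Suc n) - x * y * L n n"
      unfolding L_def sum.atMost_Suc_shift by (simp add: algebra_simps)
    finally show ?thesis .
  qed
  have "x ^ n + y ^ n = L n (n div 2) \<and> x ^ Suc n + y ^ Suc n = L (Suc n) (Suc n div 2)"
  proof (induction n)
    case 0
    then show ?case by (simp add: L_def)
  next
    case (Suc n)
    have "x ^ Suc (Suc n) + y ^ Suc (Suc n) =
        (x + y) * (x ^ Suc n + y ^ Suc n) - x * y * (x ^ n + y ^ n)"
      by (simp add: algebra_simps)
    also have "\<dots> = (x + y) * L (Suc n) (Suc n) - x * y * L n n"
      using Suc L_eq[of n n] L_eq[of "Suc n" "Suc n"] by simp
    also have "\<dots> = L (Suc (Suc n)) (Suc (Suc n) div 2)"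
      using rec[of n] L_eq[of "Suc (Suc n)" "Suc n"] by simp
    finally show ?case using Suc by blast
  qed
  then show ?thesis by (simp add: L_def)
qed


section \<open>Explicit coefficients\<close>

text \<open>Counts the ways in which \<open>j\<close> of the \<open>r + j\<close> factors a A - z B
  and \<open>k - j\<close> of the other factors contribute \<open>B\<close>; \<open>z\<close>,
  \<open>w\<close> stand for \<alpha>, \<beta>. Being free of division and polymorphic, the formula
  can be read over integer polynomials and over the reals alike.\<close>

definition psi_coeff :: "nat \<Rightarrow> nat \<Rightarrow> nat \<Rightarrow> 'a \<Rightarrow> 'a \<Rightarrow> 'a :: comm_ring_1" where
  "psi_coeff n k r z w =
     (\<Sum>j\<le>k. (-1) ^ (r + k + j) *
        of_nat (lucas_coeff n (r + j) * ((r + j) choose j) * ((n div 2 - (r + j)) choose (k - j))) *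
        z ^ j * (2 * z - w) ^ (k - j))"

definition psi :: "nat \<Rightarrow> nat \<Rightarrow> 'a \<Rightarrow> 'a \<Rightarrow> 'a \<Rightarrow> 'a \<Rightarrow> 'a :: comm_ring_1" where
  "psi n k a b z w =
     (\<Sum>r\<le>n div 2 - k. psi_coeff n k r z w * a ^ r * (2 * a - b) ^ (n div 2 - k - r))"

context unital_ring_hom
begin

lemma hom_psi_coeff: "h (psi_coeff n k r z w) = psi_coeff n k r (h z) (h w)"
  unfolding psi_coeff_def by (simp only: homs)

lemma hom_psi: "h (psi n k a b z w) = psi n k (h a) (h b) (h z) (h w)"
  unfolding psi_def by (simp only: homs hom_psi_coeff)

end

lemma psi_expansion:
  fixes a b z w A B :: "'a :: comm_ring_1" and n :: nat
  defines "m \<equiv> n div 2"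
  shows "(\<Sum>i\<le>m. (-1) ^ i * of_nat (lucas_coeff n i) * (a * A - z * B) ^ i *
            ((2 * a - b) * A - (2 * z - w) * B) ^ (m - i)) =
         (\<Sum>k\<le>m. psi n k a b z w * A ^ (m - k) * B ^ k)"
proof -
  define u v where "u = 2 * a - b" and "v = 2 * z - w"
  define c where "c i = (of_nat (lucas_coeff n i) :: 'a)" for i
  \<comment> \<open>In \<open>S\<close>, \<open>i\<close> is the Waring index and \<open>j\<close>,
    \<open>l\<close> count the factors contributing \<open>B\<close>. \<open>T\<close> regroups by
    \<open>k = j + l\<close>, the exponent of \<open>B\<close>, and \<open>r = i - j\<close>, the
    exponent of \<open>a\<close>.\<close>
  define S where "S = (SIGMA i:{..m}. {..i} \<times> {..m - i})"
  define T where "T = (SIGMA k:{..m}. {..m - k} \<times> {..k})"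
  define f where "f = (\<lambda>(i, j, l). (-1) ^ i * c i *
      (of_nat (i choose j) * (- (z * B)) ^ j * (a * A) ^ (i - j)) *
      (of_nat ((m - i) choose l) * (- (v * B)) ^ l * (u * A) ^ (m - i - l)))"
  define g where "g = (\<lambda>(k, r, j). (-1) ^ (r + k + j) *
      of_nat (lucas_coeff n (r + j) * ((r + j) choose j) * ((m - (r + j)) choose (k - j))) *
        z ^ j * v ^ (k - j) * a ^ r * u ^ (m - k - r) * A ^ (m - k) * B ^ k)"
  have "(\<Sum>i\<le>m. (-1) ^ i * c i * (a * A - z * B) ^ i * (u * A - v * B) ^ (m - i)) = sum f S"
  proof -
    have "(-1) ^ i * c i * (a * A - z * B) ^ i * (u * A - v * B) ^ (m - i) =
        (\<Sum>j\<le>i. \<Sum>l\<le>m - i. f (i, j, l))" for i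
    proof -
      have "(a * A - z * B) ^ i = (\<Sum>j\<le>i. of_nat (i choose j) * (- (z * B)) ^ j * (a * A) ^ (i - j))"
        using binomial_ring[of "- (z * B)" "a * A" i] by simp
      moreover have "(u * A - v * B) ^ (m - i) =
          (\<Sum>l\<le>m - i. of_nat ((m - i) choose l) * (- (v * B)) ^ l * (u * A) ^ (m - i - l))"
        using binomial_ring[of "- (v * B)" "u * A" "m - i"] by simp
      ultimately show ?thesis
        by (simp only: f_def prod.case sum_distrib_left sum_distrib_right mult.assoc)
           (intro sum.swap)
    qed
    then show ?thesis
      using sum.Sigma[of "{..m}" "\<lambda>i. {..i} \<times> {..m - i}" "\<lambda>i jl. f (i, jl)"]
      by (simp add: S_def sum.cartesian_product case_prod_eta)
  qed
  also have "\<dots> = sum g T"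
  proof (rule sum.reindex_bij_witness[where j = "\<lambda>(i, j, l). (j + l, i - j, j)"
        and i = "\<lambda>(k, r, j). (r + j, j, k - j)"]; clarsimp simp: S_def T_def)
    fix i j l assume *: "i \<le> m" "j \<le> i" "l \<le> m - i"
    then have exponents: "m - (j + l) - (i - j) = m - i - l" "i - j + j = i" "j + l - j = l"
      by simp_all
    have sign: "(-1 :: 'a) ^ (i - j + (j + l) + j) = (-1) ^ i * (-1) ^ j * (-1) ^ l"
      using * by (simp add: add_ac flip: power_add)
    have A: "A ^ (m - (j + l)) = A ^ (i - j) * A ^ (m - i - l)"
      using * by (simp flip: power_add)
    have minus: "(- (z * B)) ^ j = (-1) ^ j * (z ^ j * B ^ j)"
      "(- (v * B)) ^ l = (-1) ^ l * (v ^ l * B ^ l)"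
      by (simp_all only: power_minus[of "_ * B"] power_mult_distrib)
    show "g (j + l, i - j, j) = f (i, j, l)"
      unfolding f_def g_def c_def prod.case sign exponents A minus power_add[of B] of_nat_mult
        power_mult_distrib
      by (simp only: mult_ac)
  qed auto
  also have "sum g T = (\<Sum>k\<le>m. \<Sum>r\<le>m - k. \<Sum>j\<le>k. g (k, r, j))"
    using sum.Sigma[of "{..m}" "\<lambda>k. {..m - k} \<times> {..k}" "\<lambda>k rj. g (k, rj)"]
    by (simp add: T_def sum.cartesian_product case_prod_eta)
  also have "\<dots> = (\<Sum>k\<le>m. psi n k a b z w * A ^ (m - k) * B ^ k)"
    unfolding psi_def psi_coeff_def g_def u_def v_def m_def
    by (simp only: prod.case sum_distrib_left sum_distrib_right)
  finally show ?thesis by (simp only: c_def u_def v_def)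
qed

text \<open>Keeping \<open>(x + y) ^ delta n\<close> as a factor instead of dividing by it lets the
  identity hold in every commutative ring.\<close>

lemma psi_identity:
  fixes a b z w x y :: "'a :: comm_ring_1" and n :: nat
  defines "m \<equiv> n div 2"
  shows "(w * a - z * b) ^ m * (x ^ n + y ^ n) =
    (\<Sum>k\<le>m. psi n k a b z w * (z * x^2 + w * x * y + z * y^2) ^ (m - k) *
      (a * x^2 + b * x * y + a * y^2) ^ k) * (x + y) ^ delta n"
proof -
  define A B D where "A = z * x^2 + w * x * y + z * y^2" and "B = a * x^2 + b * x * y + a * y^2"
    and "D = w * a - z * b"
  have p: "a * A - z * B = D * (x * y)"
    and s: "(2 * a - b) * A - (2 * z - w) * B = D * (x + y)^2"
    unfolding A_def B_def D_def by (simp_all add: algebra_simps power2_eq_square)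
  have "(\<Sum>k\<le>m. psi n k a b z w * A ^ (m - k) * B ^ k) * (x + y) ^ delta n =
     (\<Sum>i\<le>m. (-1) ^ i * of_nat (lucas_coeff n i) * (D * (x * y)) ^ i * (D * (x + y)^2) ^ (m - i) *
        (x + y) ^ delta n)"
    unfolding sum_distrib_right[symmetric]
    using psi_expansion[of n a A z B b w] by (simp only: m_def p s)
  also have "\<dots> = (\<Sum>i\<le>m. D ^ m * ((-1) ^ i * of_nat (lucas_coeff n i) * (x * y) ^ i *
        (x + y) ^ (n - 2 * i)))"
  proof (intro sum.cong refl)
    fix i assume "i \<in> {..m}"
    \<comment> \<open>As \<open>n = 2 * m + delta n\<close>, every power of \<open>x + y\<close> is
      a power of its square times one common leftover factor.\<close>
    then have D: "D ^ m = D ^ i * D ^ (m - i)" and n: "n - 2 * i = 2 * (m - i) + delta n"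
      by (auto simp: m_def delta_def simp flip: power_add) presburger
    have "(x + y) ^ (n - 2 * i) = ((x + y)^2) ^ (m - i) * (x + y) ^ delta n"
      by (simp only: n power_add power_mult)
    then show "(-1) ^ i * of_nat (lucas_coeff n i) * (D * (x * y)) ^ i * (D * (x + y)^2) ^ (m - i) *
        (x + y) ^ delta n =
        D ^ m * ((-1) ^ i * of_nat (lucas_coeff n i) * (x * y) ^ i * (x + y) ^ (n - 2 * i))"
      by (simp only: D power_mult_distrib mult_ac)
  qed
  also have "\<dots> = D ^ m * (x ^ n + y ^ n)"
    by (simp only: power_sum_lucas m_def sum_distrib_left)
  finally show ?thesis by (simp only: A_def B_def D_def)
qed


section \<open>Existence and uniqueness\<close>

text \<open>Dividing by \<open>u t ^ m\<close> in the fraction field gives a univariate polynomial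
  with coefficients \<open>f r\<close> and roots v/u. The cross-multiplied condition makes these
  roots distinct, so there are infinitely many and the polynomial is zero.\<close>

lemma homogeneous_eq_0:
  fixes f :: "nat \<Rightarrow> 'a :: idom"
  assumes "infinite T"
    and zero: "\<And>t. t \<in> T \<Longrightarrow> (\<Sum>r\<le>m. f r * u t ^ (m - r) * v t ^ r) = 0"
    and u: "\<And>t. t \<in> T \<Longrightarrow> u t \<noteq> 0"
    and distinct: "\<And>s t. s \<in> T \<Longrightarrow> t \<in> T \<Longrightarrow> s \<noteq> t \<Longrightarrow> u s * v t \<noteq> u t * v s"
    and "r \<le> m"
  shows "f r = 0"
proof -
  interpret unital_ring_hom "to_fract :: 'a \<Rightarrow> 'a fract" by (rule unital_ring_hom_to_fract)
  define q where "q t = to_fract (v t) / to_fract (u t)" for t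
  define p where "p = (\<Sum>r\<le>m. monom (to_fract (f r)) r)"
  have "inj_on q T"
    using u distinct
    by (fastforce simp: inj_on_def q_def frac_eq_eq mult.commute simp flip: to_fract_mult)
  then have "infinite (q ` T)"
    using \<open>infinite T\<close> finite_imageD by blast
  moreover have "q ` T \<subseteq> {x. poly p x = 0}"
  proof clarify
    fix t assume t: "t \<in> T"
    have "to_fract (u t) ^ m * poly p (q t) =
        (\<Sum>r\<le>m. to_fract (f r) * to_fract (u t) ^ (m - r) * to_fract (v t) ^ r)"
      unfolding p_def poly_sum poly_monom sum_distrib_left
    proof (intro sum.cong refl)
      fix r assume "r \<in> {..m}"
      then have "to_fract (u t) ^ m = to_fract (u t) ^ (m - r) * to_fract (u t) ^ r"
        by (simp flip: power_add)
      then show "to_fract (u t) ^ m * (to_fract (f r) * q t ^ r) =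
          to_fract (f r) * to_fract (u t) ^ (m - r) * to_fract (v t) ^ r"
        using u[OF t] by (simp add: q_def power_divide)
    qed
    also have "\<dots> = to_fract (\<Sum>r\<le>m. f r * u t ^ (m - r) * v t ^ r)"
      by (simp only: homs)
    finally show "poly p (q t) = 0"
      using zero[OF t] u[OF t] by simp
  qed
  ultimately have "p = 0"
    using poly_roots_finite finite_subset by blast
  then have "coeff p r = 0" by simp
  then show ?thesis
    using \<open>r \<le> m\<close> by (simp add: p_def coeff_sum sum.delta)
qed

lemma Psi_identity_psi:
  assumes "\<And>r. r \<le> n div 2 \<Longrightarrow> P r = psi n r Var_a Var_b Var_alpha Var_beta"
  shows "Psi_identity n P"
proof -
  interpret unital_ring_hom Const_xy by (rule unital_ring_hom_Const_xy)
  define m where "m = n div 2"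
  define D where "D = Const_xy (Var_beta * Var_a - Var_alpha * Var_b)"
  define R where "R = (\<Sum>r\<le>m. Const_xy (P r) *
        quad_form Var_alpha Var_beta ^ (m - r) * quad_form Var_a Var_b ^ r)"
  define Q where "Q = (Var_x ^ n + Var_y ^ n) div (Var_x + Var_y) ^ delta n"
  have nz: "(Var_x + Var_y) ^ delta n \<noteq> 0"
    by (simp add: Var_x_def Var_y_def)
  \<comment> \<open>This makes the \<open>div\<close> in \<open>Psi_identity\<close> exact: each
    Waring term carries the exponent \<open>n - 2 * i\<close>, which has the parity of
    \<open>n\<close> and so is at least \<open>delta n\<close>.\<close>
  have "(Var_x + Var_y) ^ delta n dvd Var_x ^ n + Var_y ^ n"
    unfolding power_sum_lucas
  proof (intro dvd_sum dvd_mult le_imp_power_dvd)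
    fix i assume "i \<in> {..n div 2}"
    then show "delta n \<le> n - 2 * i" unfolding delta_def by simp presburger
  qed
  then have Q: "Var_x ^ n + Var_y ^ n = Q * (Var_x + Var_y) ^ delta n"
    unfolding Q_def by simp
  have "D ^ m * (Var_x ^ n + Var_y ^ n) = R * (Var_x + Var_y) ^ delta n"
    using psi_identity[of "Const_xy Var_beta" "Const_xy Var_a" "Const_xy Var_alpha" "Const_xy Var_b" n
        Var_x Var_y]
    by (simp add: assms D_def R_def m_def quad_form_def homs hom_psi)
  then have "(D ^ m * Q) * (Var_x + Var_y) ^ delta n = R * (Var_x + Var_y) ^ delta n"
    unfolding Q by (simp only: mult.assoc)
  then have "D ^ m * Q = R"
    by (simp only: mult_right_cancel[OF nz])
  then show ?thesis
    by (simp add: Psi_identity_def D_def Q_def R_def m_def atLeast0AtMost)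
qed

lemma Psi_identity_unique:
  assumes P: "Psi_identity n P" and Q: "Psi_identity n Q" and "r \<le> n div 2"
  shows "P r = Q r"
proof -
  define m where "m = n div 2"
  \<comment> \<open>Sets the outer variable y to 1 and the inner variable x to \<open>t\<close>,
    which turns the two forms into \<open>u t\<close> and \<open>v t\<close>.\<close>
  define ev :: "zpoly4 poly poly \<Rightarrow> nat \<Rightarrow> zpoly4" where "ev p t = poly (poly p 1) (of_nat t)" for p t
  define u where "u t = Var_alpha * (of_nat t ^ 2 + 1) + Var_beta * of_nat t" for t :: nat
  define v where "v t = Var_a * (of_nat t ^ 2 + 1) + Var_b * of_nat t" for t :: nat
  have uv: "ev (quad_form Var_alpha Var_beta) t = u t" "ev (quad_form Var_a Var_b) t = v t" for t
    by (simp_all add: ev_def quad_form_def u_def v_def Const_xy_def Var_x_def Var_y_def algebra_simps)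
  interpret ev: unital_ring_hom "\<lambda>p. ev p t" for t
    by unfold_locales (simp_all add: ev_def)
  interpret e4: unital_ring_hom "\<lambda>p. eval4 p a b \<alpha> \<beta>" for a b \<alpha> \<beta>
    by (rule unital_ring_hom_eval4)
  have [simp]: "ev (Const_xy c) t = c" for c t
    by (simp add: ev_def Const_xy_def)
  have "P r - Q r = 0"
  \<comment> \<open>Starting at 2 gives s t > 1 for the factor 1 - s t below, which reflects that x
    and 1/x give the same ratio v/u.\<close>
  proof (rule homogeneous_eq_0[where T = "{2..}" and m = m and u = u and v = v])
    show "infinite {2::nat..}" by (rule infinite_Ici)
    show "r \<le> m" using assms by (simp add: m_def)
  next
    fix t
    have "(\<Sum>r\<le>m. Const_xy (P r) * quad_form Var_alpha Var_beta ^ (m - r) * quad_form Var_a Var_b ^ r) =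
      (\<Sum>r\<le>m. Const_xy (Q r) * quad_form Var_alpha Var_beta ^ (m - r) * quad_form Var_a Var_b ^ r)"
      using P Q by (simp add: Psi_identity_def m_def atLeast0AtMost)
    from arg_cong[OF this, of "\<lambda>p. ev p t"]
    show "(\<Sum>r\<le>m. (P r - Q r) * u t ^ (m - r) * v t ^ r) = 0"
      by (simp add: ev.homs uv left_diff_distrib sum_subtractf)
  next
    fix t :: nat
    have "eval4 (u t) 0 0 1 0 = real t ^ 2 + 1"
      by (simp add: u_def e4.homs eval4_vars)
    also have "\<dots> \<noteq> 0"
      using zero_le_power2[of "real t"] by linarith
    finally show "u t \<noteq> 0"
      using e4.hom_0 by metis
  next
    fix s t :: nat
    assume st: "s \<in> {2..}" "t \<in> {2..}" "s \<noteq> t"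
    \<comment> \<open>Nonvanishing is tested at the real point a = \<beta> = 1, b = \<alpha> = 0,
      where \<open>u t\<close> becomes t and \<open>v t\<close> becomes t^2 + 1.\<close>
    have "eval4 (u s * v t - u t * v s) 1 0 0 1 = (real s - real t) * (1 - real s * real t)"
      by (simp add: u_def v_def e4.homs eval4_vars algebra_simps power2_eq_square)
    also have "\<dots> \<noteq> 0"
    proof -
      have "1 < s * t" using st by (intro less_1_mult) auto
      then have "real s * real t > 1" by (metis of_nat_1 of_nat_less_iff of_nat_mult)
      then show ?thesis using st by simp
    qed
    finally show "u s * v t \<noteq> u t * v s"
      using e4.hom_0 by (metis right_minus_eq)
  qed
  then show ?thesis by simp
qed

lemma Psi_poly_eq_psi:
  assumes "k \<le> n div 2"
  shows "Psi_poly n k = psi n k Var_a Var_b Var_alpha Var_beta"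
proof -
  define P where "P r = (if r \<le> n div 2 then psi n r Var_a Var_b Var_alpha Var_beta else 0)" for r
  have "Psi_poly n = P"
    unfolding Psi_poly_def
  proof (rule the_equality)
    show "Psi_identity n P \<and> (\<forall>r>n div 2. P r = 0)"
      using Psi_identity_psi[of n P] by (simp add: P_def)
  next
    fix Q assume Q: "Psi_identity n Q \<and> (\<forall>r>n div 2. Q r = 0)"
    have "Q r = P r" for r
      using Q Psi_identity_unique[of n Q P r] Psi_identity_psi[of n P] by (cases "r \<le> n div 2") (auto simp: P_def)
    then show "Q = P" by blast
  qed
  then show ?thesis using assms by (simp add: P_def)
qed


section \<open>The quanta prime sequence\<close>

text \<open>Unfolding is a choice of \<open>j\<close> steps raising \<open>r\<close> among
  \<open>k\<close> steps. A raising step preserves r + k, so the factors n - r - k of the other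
  steps run through the same values in any order; the raising factors depend only on
  \<open>r\<close>. Hence all choices weigh the same and are counted by
  \<open>k choose j\<close>.\<close>

lemma Omega_closed_form:
  "Omega r k z w n =
    (\<Sum>j\<le>k. real (k choose j) * (- 2 * z) ^ j * (2 * z - w) ^ (k - j) *
      (\<Prod>i<j. real n - 2 * real r - 2 * real i - real (delta (n - 1))) *
      (\<Prod>l\<in>{j<..k}. real n - real r - real l))"
proof (induction k arbitrary: r)
  case 0
  then show ?case by simp
next
  case (Suc k)
  define d where "d = real (delta (n - 1))"
  define v where "v = 2 * z - w"
  define p where "p r j = (\<Prod>i<j. real n - 2 * real r - 2 * real i - d)" for r j
  define q where "q r j k = (\<Prod>l\<in>{j<..k}. real n - real r - real l)" for r j k
  \<comment> \<open>With everything but the binomial coefficient in \<open>g\<close>, the two sums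
    of the recursion combine by Pascal's rule.\<close>
  define g where "g j = (- 2 * z) ^ j * v ^ (Suc k - j) * p r j * q r j (Suc k)" for j
  have p: "(real n - 2 * real r - d) * p (Suc r) j = p r (Suc j)" for j
    unfolding p_def prod.lessThan_Suc_shift by (simp add: algebra_simps)
  have q1: "q r j (Suc k) = q r j k * (real n - real r - real (Suc k))" if "j \<le> k" for j
  proof -
    have "{j<..Suc k} = insert (Suc k) {j<..k}" using that by auto
    then show ?thesis by (simp add: q_def mult.commute)
  qed
  have q2: "q (Suc r) j k = q r (Suc j) (Suc k)" for j
    unfolding q_def
    by (rule prod.reindex_bij_witness[where i = "\<lambda>l. l - 1" and j = Suc]) auto
  have "Omega r (Suc k) z w n = v * (real n - real r - real (Suc k)) * Omega r k z w n +
      - 2 * z * (real n - 2 * real r - d) * Omega (Suc r) k z w n"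
    by (simp add: d_def v_def)
  also have "\<dots> =
     (\<Sum>j\<le>k. v * (real n - real r - real (Suc k)) *
        (real (k choose j) * (- 2 * z) ^ j * v ^ (k - j) * p r j * q r j k)) +
     (\<Sum>j\<le>k. - 2 * z * (real n - 2 * real r - d) *
        (real (k choose j) * (- 2 * z) ^ j * v ^ (k - j) * p (Suc r) j * q (Suc r) j k))"
    unfolding Suc d_def v_def p_def q_def sum_distrib_left ..
  also have "(\<Sum>j\<le>k. v * (real n - real r - real (Suc k)) *
        (real (k choose j) * (- 2 * z) ^ j * v ^ (k - j) * p r j * q r j k)) =
      (\<Sum>j\<le>k. real (k choose j) * g j)"
    by (intro sum.cong refl) (simp add: g_def q1 Suc_diff_le)
  also have "\<dots> = (\<Sum>j\<le>Suc k. real (k choose j) * g j)"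
    by simp
  also have "\<dots> = g 0 + (\<Sum>j\<le>k. real (k choose Suc j) * g (Suc j))"
    unfolding sum.atMost_Suc_shift by simp
  also have "(\<Sum>j\<le>k. - 2 * z * (real n - 2 * real r - d) *
        (real (k choose j) * (- 2 * z) ^ j * v ^ (k - j) * p (Suc r) j * q (Suc r) j k)) =
      (\<Sum>j\<le>k. real (k choose j) * g (Suc j))"
    by (intro sum.cong refl) (simp add: g_def q2 p[symmetric])
  also have "g 0 + (\<Sum>j\<le>k. real (k choose Suc j) * g (Suc j)) + (\<Sum>j\<le>k. real (k choose j) * g (Suc j)) =
      (\<Sum>j\<le>Suc k. real (Suc k choose j) * g j)"
    unfolding sum.atMost_Suc_shift by (simp add: sum.distrib algebra_simps)
  finally show ?case
    by (simp only: g_def d_def v_def p_def q_def mult.assoc)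
qed

section \<open>Factorial forms of the products and comparison of coefficients\<close>

lemma prod_greaterThanAtMost_fact:
  assumes "j \<le> k" "r + k < n"
  shows "(\<Prod>l\<in>{j<..k}. real n - real r - real l) * fact (n - r - k - 1) = fact (n - r - j - 1)"
  using assms
proof (induction k rule: dec_induct)
  case base
  then show ?case by simp
next
  case (step k)
  have "{j<..Suc k} = insert (Suc k) {j<..k}" using step by auto
  moreover have "fact (n - r - k - 1) = (real n - real r - real (Suc k)) * fact (n - r - Suc k - 1)"
  proof -
    have "n - r - k - 1 = Suc (n - r - Suc k - 1)" using step by simp
    moreover have "real (Suc (n - r - Suc k - 1)) = real n - real r - real (Suc k)"
      using step by (simp add: of_nat_diff)
    ultimately show ?thesis by (simp only: fact_Suc)
  qed
  ultimately show ?case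
    using step by (simp add: mult_ac)
qed

text \<open>Each factor is the odd one among n - 2r - 2i and n - 2r - 2i - 1, in either parity of
  \<open>n\<close>; the even one is twice n div 2 - r - i. Together they exhaust the quotient of
  factorials.\<close>

lemma prod_step_two_fact:
  assumes "r + j \<le> n div 2"
  shows "2 ^ j * (\<Prod>i<j. real n - 2 * real r - 2 * real i - real (delta (n - 1))) *
      fact (n - 2 * (r + j)) * fact (n div 2 - r) = fact (n - 2 * r) * fact (n div 2 - (r + j))"
  using assms
proof (induction j)
  case 0
  then show ?case by simp
next
  case (Suc j)
  define t where "t = n div 2 - (r + Suc j)"
  have t: "n div 2 - (r + j) = Suc t" "n div 2 = r + j + Suc t"
    using Suc.prems by (simp_all add: t_def Suc_diff_Suc)
  have step: "2 * (real n - 2 * real r - 2 * real j - real (delta (n - 1))) * fact (n - 2 * (r + Suc j)) * real (Suc t) =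
      fact (n - 2 * (r + j))"
  proof (cases "even n")
    case True
    then have n: "n = 2 * (r + j + Suc t)" using t(2) by auto
    then have "delta (n - 1) = 1" by (simp add: delta_def)
    moreover have "n - 2 * (r + j) = Suc (Suc (2 * t))" "n - 2 * (r + Suc j) = 2 * t" using n by auto
    moreover have "real n = 2 * (real r + real j + real (Suc t))" unfolding n by simp
    ultimately show ?thesis by (simp add: algebra_simps)
  next
    case False
    then have n: "n = Suc (2 * (r + j + Suc t))" using t(2) by (metis odd_two_times_div_two_succ Suc_eq_plus1)
    then have "delta (n - 1) = 0" by (simp add: delta_def)
    moreover have "n - 2 * (r + j) = Suc (Suc (Suc (2 * t)))" "n - 2 * (r + Suc j) = Suc (2 * t)" using n by auto
    moreover have "real n = 1 + 2 * (real r + real j + real (Suc t))" unfolding n by simp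
    ultimately show ?thesis by (simp add: algebra_simps)
  qed
  have IH: "2 ^ j * (\<Prod>i<j. real n - 2 * real r - 2 * real i - real (delta (n - 1))) *
      fact (n - 2 * (r + j)) * fact (n div 2 - r) = fact (n - 2 * r) * (real (Suc t) * fact t)"
    using Suc t by (simp only: fact_Suc)
  \<comment> \<open>The extra \<open>Suc t\<close> is what \<open>step\<close> needs to absorb the
    new factor; it is cancelled afterwards.\<close>
  have "real (Suc t) * (2 ^ Suc j * (\<Prod>i<Suc j. real n - 2 * real r - 2 * real i - real (delta (n - 1))) *
      fact (n - 2 * (r + Suc j)) * fact (n div 2 - r)) = real (Suc t) * (fact (n - 2 * r) * fact t)"
    using IH unfolding step[symmetric] power_Suc prod.lessThan_Suc by (simp only: mult_ac)
  then show ?case unfolding t_def[symmetric] by (simp only: mult_left_cancel[OF of_nat_neq_0])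
qed

text \<open>The sums over \<open>j\<close> agree term by term once \<open>Omega\<close> is in closed
  form and all binomials are factorial quotients; integrality then follows from the division-free
  side.\<close>

lemma Psi_coeff_eq_psi_coeff:
  assumes "n \<ge> 1" "r + k \<le> n div 2"
  shows "Psi_coeff n k r z w = psi_coeff n k r z w"
proof -
  have "(-1) ^ (r + k) * (fact (n - r - k - 1) * real n / (fact (n - 2 * r) * fact r)) *
      real ((n div 2 - r) choose k) *
      (real (k choose j) * (- 2 * z) ^ j * (2 * z - w) ^ (k - j) *
      (\<Prod>i<j. real n - 2 * real r - 2 * real i - real (delta (n - 1))) *
      (\<Prod>l\<in>{j<..k}. real n - real r - real l)) =
    (-1) ^ (r + k + j) *
        of_nat (lucas_coeff n (r + j) * ((r + j) choose j) * ((n div 2 - (r + j)) choose (k - j))) *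
        z ^ j * (2 * z - w) ^ (k - j)" if j: "j \<le> k" for j
  proof -
    define p where "p = (\<Prod>i<j. real n - 2 * real r - 2 * real i - real (delta (n - 1)))"
    define q where "q = (\<Prod>l\<in>{j<..k}. real n - real r - real l)"
    have q: "q = fact (n - r - j - 1) / fact (n - r - k - 1)"
      using prod_greaterThanAtMost_fact[of j k r n] j assms unfolding q_def by (simp add: field_simps)
    have p: "2 ^ j * p = fact (n - 2 * r) * fact (n div 2 - (r + j)) /
        (fact (n - 2 * (r + j)) * fact (n div 2 - r))"
      using prod_step_two_fact[of r j n] j assms unfolding p_def by (simp add: field_simps)
    have "real (lucas_coeff n (r + j) * fact (n - 2 * (r + j)) * fact (r + j)) =
        real (n * fact (n - (r + j) - 1))"
      using lucas_coeff_fact[of n "r + j"] j assms by simp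
    then have l: "real (lucas_coeff n (r + j)) =
        real n * fact (n - r - j - 1) / (fact (n - 2 * (r + j)) * fact (r + j))"
      by (simp add: field_simps)
    have c: "real ((n div 2 - r) choose k) = fact (n div 2 - r) / (fact k * fact (n div 2 - r - k))"
      "real (k choose j) = fact k / (fact j * fact (k - j))"
      "real ((r + j) choose j) = fact (r + j) / (fact j * fact r)"
      "real ((n div 2 - (r + j)) choose (k - j)) =
        fact (n div 2 - (r + j)) / (fact (k - j) * fact (n div 2 - r - k))"
      using j assms by (simp_all add: binomial_fact)
    \<comment> \<open>The power \<open>2 ^ j\<close> taken from \<open>(- 2 * z) ^ j\<close> is
      grouped with \<open>p\<close>, since only their product has the factorial form.\<close>
    have main: "fact (n - r - k - 1) * real n / (fact (n - 2 * r) * fact r) *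
      real ((n div 2 - r) choose k) * real (k choose j) * (2 ^ j * p) * q =
      real (lucas_coeff n (r + j)) * real ((r + j) choose j) *
      real ((n div 2 - (r + j)) choose (k - j))"
      unfolding p q l c by (simp add: divide_simps)
    have "(- 2 * z) ^ j = (-1) ^ j * 2 ^ j * z ^ j"
      by (simp flip: power_mult_distrib)
    then have "(-1) ^ (r + k) * (fact (n - r - k - 1) * real n / (fact (n - 2 * r) * fact r)) *
      real ((n div 2 - r) choose k) *
      (real (k choose j) * (- 2 * z) ^ j * (2 * z - w) ^ (k - j) * p * q) =
      (-1) ^ (r + k + j) * (fact (n - r - k - 1) * real n / (fact (n - 2 * r) * fact r) *
      real ((n div 2 - r) choose k) * real (k choose j) * (2 ^ j * p) * q) *
        z ^ j * (2 * z - w) ^ (k - j)"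
      by (simp only: power_add mult_ac)
    then show ?thesis
      unfolding main by (simp only: p_def q_def of_nat_mult)
  qed
  then show ?thesis
    unfolding Psi_coeff_def psi_coeff_def Omega_closed_form sum_distrib_left
    by (intro sum.cong) simp_all
qed

section \<open>Specialization to real parameters and integrality of the coefficients\<close>

theorem theorem1:
  fixes n k :: nat and a b \<alpha> \<beta> :: real
  assumes "n \<ge> 1" and "k \<le> n div 2" and "\<beta> * a - \<alpha> * b \<noteq> 0"
  shows "Psi a b \<alpha> \<beta> n k =
           (\<Sum>r = 0..n div 2 - k. Psi_coeff n k r \<alpha> \<beta> * a ^ r * (2 * a - b) ^ (n div 2 - k - r))
         \<and> (\<forall>r \<le> n div 2 - k. \<exists>p :: int poly poly. \<forall>s t. Psi_coeff n k r s t = eval2 p s t)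
         \<and> (\<alpha> \<in> \<int> \<and> \<beta> \<in> \<int> \<longrightarrow> (\<forall>r \<le> n div 2 - k. Psi_coeff n k r \<alpha> \<beta> \<in> \<int>))"
proof (intro conjI allI impI)
  have coeff: "Psi_coeff n k r s t = psi_coeff n k r s t" if "r \<le> n div 2 - k" for r s t
    using that assms by (intro Psi_coeff_eq_psi_coeff) auto
  have "Psi a b \<alpha> \<beta> n k = psi n k a b \<alpha> \<beta>"
    using assms(2)
    by (simp add: Psi_def Psi_poly_eq_psi unital_ring_hom.hom_psi[OF unital_ring_hom_eval4] eval4_vars)
  then show "Psi a b \<alpha> \<beta> n k =
      (\<Sum>r = 0..n div 2 - k. Psi_coeff n k r \<alpha> \<beta> * a ^ r * (2 * a - b) ^ (n div 2 - k - r))"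
    by (simp add: psi_def coeff atLeast0AtMost)
  fix r assume r: "r \<le> n div 2 - k"
  show "\<exists>p :: int poly poly. \<forall>s t. Psi_coeff n k r s t = eval2 p s t"
    \<comment> \<open>The witness is the division-free coefficient at the two indeterminates, the
      inner one for \<alpha> and the outer one for \<beta>.\<close>
    by (intro exI[of _ "psi_coeff n k r [:[:0, 1:]:] [:0, 1:]"])
       (simp add: coeff[OF r] unital_ring_hom.hom_psi_coeff[OF unital_ring_hom_eval2] eval2_vars)
  assume "\<alpha> \<in> \<int> \<and> \<beta> \<in> \<int>"
  then show "Psi_coeff n k r \<alpha> \<beta> \<in> \<int>"
    unfolding coeff[OF r] psi_coeff_def by auto
qed

end
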